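(* Let $q\in\mathbb{C}$, $q\ne0$, $q^2\neq1$, let $T=\begin{pmatrix}a&b\\ c&d\end{pmatrix}$ and let $S14$ be the unital associative $\mathbb{C}$-algebra generated by $a,b,c,d$ subject to the relations $R\,T_1T_2=T_2T_1R$ with $$R=R_{S1,4}=\begin{pmatrix}0&0&0&q\\ 0&0&1&0\\ 0&1&0&0\\ q&0&0&0\end{pmatrix}.$$ Then these relations are equivalent to $$b^2-c^2=0,\quad a^2-d^2=0,\quad ab=ba=0,\quad ac=ca=0,\quad bd=db=0,\quad cd=dc=0 .$$ In terms of $\tilde a=\frac12(a+d)$, $\tilde d=\frac12(a-d)$, $\tilde b=\frac12(b+c)$, $\tilde c=\frac12(b-c)$ they are equivalent to $$\tilde b\tilde c+\tilde c\tilde b=0,\ \tilde a\tilde d+\tilde d\tilde a=0,\ \tilde a\tilde b=\tilde b\tilde a=0,\ \tilde a\tilde c=\tilde c\tilde a=0,\ \tilde b\tilde d=\tilde d\tilde b=0,\ \tilde c\tilde d=\tilde d\tilde c=0 .$$ A (PBW) basis of $S14$ is given by the monomials $\tilde a^k\tilde d^\ell$ and $\tilde b^k\tilde c^\ell$, $k,\ell\ge0$ (the unit being counted once).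
   Context: $T_1=T\otimes\mathbf 1_2$ and $T_2=\mathbf 1_2\otimes T$ are $4\times4$ matrices with entries in the algebra, rows and columns indexed by pairs $11,12,21,22$: $(T_1T_2)_{ij,kl}=T_{ik}T_{jl}$ and $(T_2T_1)_{ij,kl}=T_{jl}T_{ik}$. *)

theory Defs
  imports
    "HOL-Analysis.Analysis"
    "HOL-Library.Poly_Mapping"
    "HOL-Algebra.QuotRing"
    "Jordan_Normal_Form.Missing_VectorSpace"
begin

section \<open>Matrices with entries in a complex algebra\<close>

locale complex_algebra = vector_space sc
  for sc :: "complex \<Rightarrow> 'a::ring_1 \<Rightarrow> 'a" +
  assumes scale_mult_left: "sc c x * y = sc c (x * y)"
    and scale_mult_right: "x * sc c y = sc c (x * y)"

definition kron :: "'a::times^'n^'m \<Rightarrow> 'a^'l^'k \<Rightarrow> 'a^('n \<times> 'l)^('m \<times> 'k)" where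
  "kron A B = (\<chi> i j. A $ fst i $ fst j * B $ snd i $ snd j)"

definition matrix_T :: "'a::zero \<Rightarrow> 'a \<Rightarrow> 'a \<Rightarrow> 'a \<Rightarrow> 'a^2^2" where
  "matrix_T a b c d = vector [vector [a, b], vector [c, d]]"

definition T1 :: "'a::ring_1^2^2 \<Rightarrow> 'a^(2 \<times> 2)^(2 \<times> 2)" where
  "T1 T = kron T (mat 1)"

definition T2 :: "'a::ring_1^2^2 \<Rightarrow> 'a^(2 \<times> 2)^(2 \<times> 2)" where
  "T2 T = kron (mat 1) T"

lemma T1_T2_entry: "(T1 T ** T2 T) $ (i, j) $ (k, l) = T $ i $ k * T $ j $ l"
proof -
  have "(T1 T ** T2 T) $ (i, j) $ (k, l)
      = (\<Sum>(m, n)\<in>UNIV \<times> UNIV. (T $ i $ m * (if j = n then 1 else 0)) * ((if m = k then 1 else 0) * T $ n $ l))"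
    by (simp add: matrix_matrix_mult_def T1_def T2_def kron_def mat_def case_prod_beta)
  also have "\<dots> = (\<Sum>m\<in>UNIV. \<Sum>n\<in>UNIV. if n = j then (if m = k then T $ i $ k * T $ j $ l else 0) else 0)"
    unfolding sum.cartesian_product[symmetric] by (intro sum.cong refl) auto
  finally show ?thesis by simp
qed

lemma T2_T1_entry: "(T2 T ** T1 T) $ (i, j) $ (k, l) = T $ j $ l * T $ i $ k"
proof -
  have "(T2 T ** T1 T) $ (i, j) $ (k, l)
      = (\<Sum>(m, n)\<in>UNIV \<times> UNIV. ((if i = m then 1 else 0) * T $ j $ n) * (T $ m $ k * (if n = l then 1 else 0)))"
    by (simp add: matrix_matrix_mult_def T1_def T2_def kron_def mat_def case_prod_beta)
  also have "\<dots> = (\<Sum>m\<in>UNIV. \<Sum>n\<in>UNIV. if n = l then (if m = i then T $ j $ l * T $ i $ k else 0) else 0)"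
    unfolding sum.cartesian_product[symmetric] by (intro sum.cong refl) auto
  finally show ?thesis by simp
qed

text \<open>Rows and columns 11, 12, 21, 22 are the pairs over the index type \<open>2\<close>, whose elements are \<open>1\<close>
  and \<open>2\<close>.\<close>

definition R_S14 :: "complex \<Rightarrow> complex^(2 \<times> 2)^(2 \<times> 2)" where
  "R_S14 q = (\<chi> i j.
     if (i, j) \<in> {((1, 1), (2, 2)), ((2, 2), (1, 1))} then q
     else if (i, j) \<in> {((1, 2), (2, 1)), ((2, 1), (1, 2))} then 1
     else 0)"

definition scalar_matrix :: "(complex \<Rightarrow> 'a::ring_1 \<Rightarrow> 'a) \<Rightarrow> complex^'n^'m \<Rightarrow> 'a^'n^'m" where
  "scalar_matrix sc M = (\<chi> i j. sc (M $ i $ j) 1)"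


section \<open>Systems of relations, as sets of pairs (left-hand side, right-hand side)\<close>

definition satisfied :: "('a \<times> 'a) set \<Rightarrow> bool" where
  "satisfied S \<longleftrightarrow> (\<forall>(l, r)\<in>S. l = r)"

definition RTT_relations ::
  "(complex \<Rightarrow> 'a::ring_1 \<Rightarrow> 'a) \<Rightarrow> complex \<Rightarrow> 'a \<Rightarrow> 'a \<Rightarrow> 'a \<Rightarrow> 'a \<Rightarrow> ('a \<times> 'a) set" where
  "RTT_relations sc q a b c d =
    (let T = matrix_T a b c d; R = scalar_matrix sc (R_S14 q) in
     {((R ** (T1 T ** T2 T)) $ i $ j, ((T2 T ** T1 T) ** R) $ i $ j) | i j. True})"

definition explicit_relations :: "'a::ring_1 \<Rightarrow> 'a \<Rightarrow> 'a \<Rightarrow> 'a \<Rightarrow> ('a \<times> 'a) set" where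
  "explicit_relations a b c d =
    {(b^2 - c^2, 0), (a^2 - d^2, 0),
     (a * b, 0), (b * a, 0), (a * c, 0), (c * a, 0),
     (b * d, 0), (d * b, 0), (c * d, 0), (d * c, 0)}"

definition tilde_relations :: "'a::ring_1 \<Rightarrow> 'a \<Rightarrow> 'a \<Rightarrow> 'a \<Rightarrow> ('a \<times> 'a) set" where
  "tilde_relations a' b' c' d' =
    {(b' * c' + c' * b', 0), (a' * d' + d' * a', 0),
     (a' * b', 0), (b' * a', 0), (a' * c', 0), (c' * a', 0),
     (b' * d', 0), (d' * b', 0), (c' * d', 0), (d' * c', 0)}"


section \<open>The free algebra on four generators\<close>

instantiation list :: (type) monoid_add
begin

definition zero_list :: "'a list" where "0 = []"

definition plus_list :: "'a list \<Rightarrow> 'a list \<Rightarrow> 'a list" where "xs + ys = xs @ ys"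

instance by standard (simp_all add: zero_list_def plus_list_def)

end

datatype generator = Gen_a | Gen_b | Gen_c | Gen_d

text \<open>The monoid algebra of the free monoid of words: its product, the convolution of finitely
  supported functions, extends the concatenation of words.\<close>

type_synonym free_algebra = "generator list \<Rightarrow>\<^sub>0 complex"

definition var :: "generator \<Rightarrow> free_algebra" where
  "var g = Poly_Mapping.single [g] 1"

definition free_scale :: "complex \<Rightarrow> free_algebra \<Rightarrow> free_algebra" where
  "free_scale c x = Poly_Mapping.map ((*) c) x"

lemma free_scale_eq: "free_scale c x = Poly_Mapping.single 0 c * x"
proof -
  have "Poly_Mapping.single 0 c * x = Poly_Mapping.map ((*) c) x"
    by (simp add: mult_map_scale_conv_mult)
  then show ?thesis by (simp add: free_scale_def)
qed

lemma single_0_central: "Poly_Mapping.single 0 c * x = x * Poly_Mapping.single 0 c" for x :: free_algebra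
proof (induction x rule: update_induct)
  case (update f k v)
  have "Poly_Mapping.update k v f = Poly_Mapping.single k v + f"
    using update(1)
    by (intro poly_mapping_eqI) (auto simp: lookup_update lookup_add lookup_single in_keys_iff when_def)
  then show ?case
    using update by (simp add: distrib_left distrib_right mult_single mult.commute)
qed simp

interpretation free_algebra: complex_algebra free_scale
proof
  fix c d :: complex and x y :: free_algebra
  show "free_scale c (x + y) = free_scale c x + free_scale c y"
    and "free_scale (c + d) x = free_scale c x + free_scale d x"
    by (simp_all add: free_scale_eq distrib_left distrib_right single_add)
  show "free_scale c (free_scale d x) = free_scale (c * d) x"
    by (simp add: free_scale_eq mult.assoc[symmetric] mult_single)
  show "free_scale 1 x = x"
    by (simp add: free_scale_eq)
  show "free_scale c x * y = free_scale c (x * y)"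
    by (simp add: free_scale_eq mult.assoc)
  show "x * free_scale c y = free_scale c (x * y)"
    unfolding free_scale_eq by (metis mult.assoc single_0_central)
qed

abbreviation free_ring :: "free_algebra ring" where
  "free_ring \<equiv> \<lparr>carrier = UNIV, mult = (*), one = 1, zero = 0, add = (+)\<rparr>"

abbreviation complex_field :: "complex ring" where
  "complex_field \<equiv> \<lparr>carrier = UNIV, mult = (*), one = 1, zero = 0, add = (+)\<rparr>"

text \<open>The two-sided ideal by which the relations are imposed.\<close>

definition relation_ideal :: "(free_algebra \<times> free_algebra) set \<Rightarrow> free_algebra set" where
  "relation_ideal S = Idl\<^bsub>free_ring\<^esub> {l - r | l r. (l, r) \<in> S}"


section \<open>The algebra S14\<close>

definition S14_ideal :: "complex \<Rightarrow> free_algebra set" where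
  "S14_ideal q =
    relation_ideal (RTT_relations free_scale q (var Gen_a) (var Gen_b) (var Gen_c) (var Gen_d))"

definition S14_class :: "complex \<Rightarrow> free_algebra \<Rightarrow> free_algebra set" where
  "S14_class q x = S14_ideal q +>\<^bsub>free_ring\<^esub> x"

text \<open>The quotient ring of the free algebra, with the scalar \<open>s\<close> acting as the class of \<open>s\<close>. A record of
  type \<open>module\<close> carries both a ring structure and a scalar multiplication.\<close>

definition S14 :: "complex \<Rightarrow> (complex, free_algebra set) module" where
  "S14 q = ring.extend (free_ring Quot S14_ideal q)
     (module.fields (\<lambda>s X. S14_class q (free_scale s 1) \<otimes>\<^bsub>free_ring Quot S14_ideal q\<^esub> X))"

definition S14_a :: "complex \<Rightarrow> free_algebra set" where
  "S14_a q = (1/2) \<odot>\<^bsub>S14 q\<^esub> (S14_class q (var Gen_a) \<oplus>\<^bsub>S14 q\<^esub> S14_class q (var Gen_d))"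

definition S14_d :: "complex \<Rightarrow> free_algebra set" where
  "S14_d q = (1/2) \<odot>\<^bsub>S14 q\<^esub> (S14_class q (var Gen_a) \<ominus>\<^bsub>S14 q\<^esub> S14_class q (var Gen_d))"

definition S14_b :: "complex \<Rightarrow> free_algebra set" where
  "S14_b q = (1/2) \<odot>\<^bsub>S14 q\<^esub> (S14_class q (var Gen_b) \<oplus>\<^bsub>S14 q\<^esub> S14_class q (var Gen_c))"

definition S14_c :: "complex \<Rightarrow> free_algebra set" where
  "S14_c q = (1/2) \<odot>\<^bsub>S14 q\<^esub> (S14_class q (var Gen_b) \<ominus>\<^bsub>S14 q\<^esub> S14_class q (var Gen_c))"

text \<open>The four elements above are the tilde generators, formed inside \<open>S14 q\<close>.\<close>

definition mono_ad :: "complex \<Rightarrow> nat \<times> nat \<Rightarrow> free_algebra set" where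
  "mono_ad q = (\<lambda>(k, l). S14_a q [^]\<^bsub>S14 q\<^esub> k \<otimes>\<^bsub>S14 q\<^esub> S14_d q [^]\<^bsub>S14 q\<^esub> l)"

definition mono_bc :: "complex \<Rightarrow> nat \<times> nat \<Rightarrow> free_algebra set" where
  "mono_bc q = (\<lambda>(k, l). S14_b q [^]\<^bsub>S14 q\<^esub> k \<otimes>\<^bsub>S14 q\<^esub> S14_c q [^]\<^bsub>S14 q\<^esub> l)"

lemma ring_free_ring: "ring free_ring"
proof (rule ringI)
  show "abelian_group free_ring"
    by (rule abelian_groupI) (auto simp: algebra_simps intro: exI[of _ "- x" for x])
  show "monoid free_ring"
    by (rule monoidI) (auto simp: mult.assoc)
qed (auto simp: distrib_left distrib_right)

lemma ideal_S14_ideal: "ideal (S14_ideal q) free_ring"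
  unfolding S14_ideal_def relation_ideal_def
  by (rule ring.genideal_ideal[OF ring_free_ring]) simp

lemma S14_sel:
  "carrier (S14 q) = carrier (free_ring Quot S14_ideal q)"
  "mult (S14 q) = mult (free_ring Quot S14_ideal q)"
  "one (S14 q) = one (free_ring Quot S14_ideal q)"
  "zero (S14 q) = zero (free_ring Quot S14_ideal q)"
  "add (S14 q) = add (free_ring Quot S14_ideal q)"
  "smult (S14 q) = (\<lambda>s X. S14_class q (free_scale s 1) \<otimes>\<^bsub>free_ring Quot S14_ideal q\<^esub> X)"
  by (simp_all add: S14_def ring.defs module.defs)

lemma S14_carrier: "carrier (S14 q) = range (S14_class q)"
  by (auto simp: S14_sel FactRing_def A_RCOSETS_def' S14_class_def)

lemma S14_class_simps:
  "S14_class q x \<oplus>\<^bsub>S14 q\<^esub> S14_class q y = S14_class q (x + y)"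
  "S14_class q x \<otimes>\<^bsub>S14 q\<^esub> S14_class q y = S14_class q (x * y)"
  "\<one>\<^bsub>S14 q\<^esub> = S14_class q 1"
  "\<zero>\<^bsub>S14 q\<^esub> = S14_class q 0"
  "s \<odot>\<^bsub>S14 q\<^esub> S14_class q x = S14_class q (free_scale s x)"
proof -
  have hom: "S14_class q \<in> ring_hom free_ring (free_ring Quot S14_ideal q)"
    using ideal.rcos_ring_hom[OF ideal_S14_ideal] by (simp add: S14_class_def[abs_def])
  show "S14_class q x \<oplus>\<^bsub>S14 q\<^esub> S14_class q y = S14_class q (x + y)"
    using ring_hom_add[OF hom, of x y] by (simp add: S14_sel)
  show m: "S14_class q x \<otimes>\<^bsub>S14 q\<^esub> S14_class q y = S14_class q (x * y)" for x y
    using ring_hom_mult[OF hom, of x y] by (simp add: S14_sel)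
  show "\<one>\<^bsub>S14 q\<^esub> = S14_class q 1"
    using ring_hom_one[OF hom] by (simp add: S14_sel)
  show "\<zero>\<^bsub>S14 q\<^esub> = S14_class q 0"
    using ring_hom_zero[OF hom ring_free_ring ideal.quotient_is_ring[OF ideal_S14_ideal]]
    by (simp add: S14_sel)
  have "s \<odot>\<^bsub>S14 q\<^esub> S14_class q x = S14_class q (free_scale s 1) \<otimes>\<^bsub>S14 q\<^esub> S14_class q x"
    by (simp add: S14_sel)
  then show "s \<odot>\<^bsub>S14 q\<^esub> S14_class q x = S14_class q (free_scale s x)"
    by (simp add: m free_algebra.scale_mult_left)
qed

lemma abelian_group_S14: "abelian_group (S14 q)"
proof (rule abelian_groupI)
  fix X assume "X \<in> carrier (S14 q)"
  then obtain x where "X = S14_class q x" by (auto simp: S14_carrier)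
  then show "\<exists>Y\<in>carrier (S14 q). Y \<oplus>\<^bsub>S14 q\<^esub> X = \<zero>\<^bsub>S14 q\<^esub>"
    by (intro bexI[of _ "S14_class q (- x)"]) (auto simp: S14_carrier S14_class_simps)
qed (auto simp: S14_carrier S14_class_simps algebra_simps)

lemma ring_S14: "ring (S14 q)"
proof (rule ringI[OF abelian_group_S14])
  show "monoid (S14 q)"
    by (rule monoidI) (auto simp: S14_carrier S14_class_simps mult.assoc)
qed (auto simp: S14_carrier S14_class_simps algebra_simps)

lemma field_complex_field: "field complex_field"
proof -
  have "cring complex_field"
    by (intro cringI abelian_groupI comm_monoidI)
       (auto simp: algebra_simps intro: exI[of _ "- x" for x])
  then show ?thesis
    by (rule cring.cring_fieldI2) (auto intro: right_inverse)
qed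

lemma vectorspace_S14: "vectorspace complex_field (S14 q)"
  unfolding vectorspace_def
proof
  show "Module.module complex_field (S14 q)"
  proof (rule moduleI)
    show "cring complex_field"
      using field_complex_field by (simp add: field_def domain_def)
  qed (auto simp: abelian_group_S14 S14_carrier S14_class_simps
      free_algebra.scale_left_distrib free_algebra.scale_right_distrib)
qed (rule field_complex_field)

lemma S14_smult_mult:
  assumes "X \<in> carrier (S14 q)" and "Y \<in> carrier (S14 q)"
  shows "(s \<odot>\<^bsub>S14 q\<^esub> X) \<otimes>\<^bsub>S14 q\<^esub> Y = s \<odot>\<^bsub>S14 q\<^esub> (X \<otimes>\<^bsub>S14 q\<^esub> Y)"
    and "X \<otimes>\<^bsub>S14 q\<^esub> (s \<odot>\<^bsub>S14 q\<^esub> Y) = s \<odot>\<^bsub>S14 q\<^esub> (X \<otimes>\<^bsub>S14 q\<^esub> Y)"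
  using assms
  by (auto simp: S14_carrier S14_class_simps free_algebra.scale_mult_left free_algebra.scale_mult_right)

end

theory Submission
  imports Defs
begin

text \<open>Comparing entries of the two sides pairs the relations off as \<open>q x = y\<close>, \<open>q y = x\<close> with
  \<open>x, y\<close> products of a generator among \<open>a, d\<close> and one among \<open>b, c\<close>; as \<open>q\<^sup>2 \<noteq> 1\<close>, both vanish.
  All three systems of relations are then linear combinations of each other, so they are equivalent
  modulo every subspace: modulo \<open>0\<close> this is the equivalence in an algebra, modulo ideals the equality
  of the ideals that they generate.

  The tilde monomials span because left multiplication by a tilde generator moves a monomial to a signed
  monomial or kills it. For independence, the tilde generators \<open>a, d\<close> act as the two raising operators
  (the second with a sign) on one copy of the functions on \<open>\<nat>\<^sup>2\<close> and by zero on a second copy, and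
  \<open>b, c\<close> the other way round; applied to the sum of the two vacuum vectors, the monomials other than the
  unit give distinct basis vectors.\<close>

subsection \<open>Equivalence of the relations modulo a subspace\<close>

text \<open>In the index type \<open>2\<close> addition is modulo 2, so \<open>i + 1\<close> is the
  other index; this turns the position of the nonzero entries of \<open>R_S14 q\<close> into a
  single formula.\<close>

lemma exchange_2: "(1::2) \<noteq> 2" "(2::2) \<noteq> 1" "(1::2) + 1 = 2" "(2::2) + 1 = 1"
  by simp_all

lemma R_S14_entry:
  "R_S14 q $ (i, j) $ (k, l) = (if (k, l) = (i + 1, j + 1) then if i = j then q else 1 else 0)"
proof -
  have "\<forall>i j k l. R_S14 q $ (i, j) $ (k, l) =
      (if (k, l) = (i + 1, j + 1) then if i = j then q else 1 else 0)"
    unfolding forall_2 R_S14_def vec_lambda_beta exchange_2 by simp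
  then show ?thesis by blast
qed

lemma exchange_2_eq_iff: "k = i + 1 \<longleftrightarrow> i = k + 1" for i k :: 2
proof -
  have "\<forall>i k :: 2. k = i + 1 \<longleftrightarrow> i = k + 1"
    unfolding forall_2 exchange_2 by simp
  then show ?thesis by blast
qed

lemma matrix_T_entry:
  "matrix_T a b c d $ 1 $ 1 = a" "matrix_T a b c d $ 1 $ 2 = b"
  "matrix_T a b c d $ 2 $ 1 = c" "matrix_T a b c d $ 2 $ 2 = d"
  by (simp_all add: matrix_T_def)

lemma relations_mod_singleton_zero:
  "satisfied S \<longleftrightarrow> (\<forall>(l, r)\<in>S. l - r \<in> {0})" for S :: "('a::ring_1 \<times> 'a) set"
  by (auto simp: satisfied_def)

context complex_algebra
begin

text \<open>Each row of \<open>R_S14 q\<close> has exactly one nonzero place, so left multiplication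
  only permutes rows and scales them.\<close>

lemma R_S14_mult_entry:
  "(scalar_matrix sc (R_S14 q) ** M) $ (i, j) $ p = sc (if i = j then q else 1) (M $ (i + 1, j + 1) $ p)"
proof -
  have "(scalar_matrix sc (R_S14 q) ** M) $ (i, j) $ p =
      (\<Sum>r\<in>UNIV. if r = (i + 1, j + 1) then sc (if i = j then q else 1) (M $ r $ p) else 0)"
    unfolding matrix_matrix_mult_def scalar_matrix_def vec_lambda_beta
    by (intro sum.cong refl) (simp add: split_paired_all R_S14_entry scale_mult_left)
  then show ?thesis by simp
qed

lemma mult_R_S14_entry:
  "(M ** scalar_matrix sc (R_S14 q)) $ p $ (k, l) = sc (if k = l then q else 1) (M $ p $ (k + 1, l + 1))"
proof -
  have "(M ** scalar_matrix sc (R_S14 q)) $ p $ (k, l) =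
      (\<Sum>r\<in>UNIV. if r = (k + 1, l + 1) then sc (if k = l then q else 1) (M $ p $ r) else 0)"
    unfolding matrix_matrix_mult_def scalar_matrix_def vec_lambda_beta
    by (intro sum.cong refl)
      (auto simp: split_paired_all R_S14_entry scale_mult_right exchange_2_eq_iff[of k] exchange_2_eq_iff[of l])
  then show ?thesis by simp
qed

lemma RTT_relations_mod:
  "(\<forall>(l, r)\<in>RTT_relations sc q a b c d. l - r \<in> J) \<longleftrightarrow>
    (\<forall>i j k l. sc (if i = j then q else 1) (matrix_T a b c d $ (i + 1) $ k * matrix_T a b c d $ (j + 1) $ l)
      - sc (if k = l then q else 1) (matrix_T a b c d $ j $ (l + 1) * matrix_T a b c d $ i $ (k + 1)) \<in> J)"
proof -
  have "(\<forall>(l, r)\<in>RTT_relations sc q a b c d. l - r \<in> J) \<longleftrightarrow> (\<forall>i j.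
      (scalar_matrix sc (R_S14 q) ** (T1 (matrix_T a b c d) ** T2 (matrix_T a b c d))) $ i $ j
      - ((T2 (matrix_T a b c d) ** T1 (matrix_T a b c d)) ** scalar_matrix sc (R_S14 q)) $ i $ j \<in> J)"
    unfolding RTT_relations_def Let_def by blast
  then show ?thesis
    by (simp only: split_paired_All R_S14_mult_entry mult_R_S14_entry T1_T2_entry T2_T1_entry)
qed

text \<open>Adding the second element to \<open>q\<close> times the first eliminates
  \<open>y\<close> and leaves \<open>(q^2 - 1) x\<close>.\<close>

lemma crossed_pair_mod:
  assumes J: "subspace J" and q: "q^2 \<noteq> 1"
  shows "sc q x - y \<in> J \<and> sc q y - x \<in> J \<longleftrightarrow> x \<in> J \<and> y \<in> J"
proof (intro iffI conjI; (elim conjE)?)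
  assume *: "sc q x - y \<in> J" "sc q y - x \<in> J"
  have "sc (1 / (q^2 - 1)) (sc q (sc q x - y) + (sc q y - x)) \<in> J"
    using * J by (intro subspace_scale subspace_add)
  also have "sc q (sc q x - y) + (sc q y - x) = sc (q^2 - 1) x"
    by (simp add: scale_right_diff_distrib scale_left_diff_distrib power2_eq_square)
  finally show x: "x \<in> J"
    using q by simp
  have "sc q x - (sc q x - y) \<in> J"
    by (rule subspace_diff[OF J subspace_scale[OF J x] *(1)])
  then show "y \<in> J" by simp
qed (use J in \<open>auto intro!: subspace_diff subspace_scale\<close>)

lemma scale_mem_iff: "subspace J \<Longrightarrow> s \<noteq> 0 \<Longrightarrow> sc s x \<in> J \<longleftrightarrow> x \<in> J"
  using subspace_scale[of J x s] subspace_scale[of J "sc s x" "1/s"] by auto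

text \<open>Of the sixteen entries, the four with \<open>i \<noteq> j\<close> and
  \<open>k \<noteq> l\<close> vanish identically. The four with \<open>i = j\<close> and
  \<open>k = l\<close> give two differences of squares, each twice up to sign and scaled by
  \<open>q\<close>. The other eight form four crossed pairs.\<close>

lemma explicit_relations_mod:
  assumes J: "subspace J" and q0: "q \<noteq> 0" and q: "q^2 \<noteq> 1"
  shows "(\<forall>(l, r)\<in>RTT_relations sc q a b c d. l - r \<in> J) \<longleftrightarrow>
    (\<forall>(l, r)\<in>explicit_relations a b c d. l - r \<in> J)"
proof -
  have sc_diff: "sc q x - sc q y \<in> J \<longleftrightarrow> x - y \<in> J" for x y
    using scale_mem_iff[OF J q0, of "x - y"] by (simp add: scale_right_diff_distrib)
  have minus: "x - y \<in> J \<longleftrightarrow> y - x \<in> J" for x y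
    using subspace_neg[OF J, of "x - y"] subspace_neg[OF J, of "y - x"] by auto
  have "(\<forall>(l, r)\<in>RTT_relations sc q a b c d. l - r \<in> J) \<longleftrightarrow>
      b^2 - c^2 \<in> J \<and> a^2 - d^2 \<in> J \<and>
      (sc q (a * b) - c * d \<in> J \<and> sc q (c * d) - a * b \<in> J) \<and>
      (sc q (b * a) - d * c \<in> J \<and> sc q (d * c) - b * a \<in> J) \<and>
      (sc q (a * c) - b * d \<in> J \<and> sc q (b * d) - a * c \<in> J) \<and>
      (sc q (c * a) - d * b \<in> J \<and> sc q (d * b) - c * a \<in> J)"
    unfolding RTT_relations_mod forall_2 exchange_2 matrix_T_entry
    \<comment> \<open>These instances orient the entries that appear with the opposite sign.\<close>
    using minus[of "c * c" "b * b"] minus[of "d * d" "a * a"]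
      minus[of "c * a" "sc q (d * b)"] minus[of "a * c" "sc q (b * d)"]
      minus[of "d * b" "sc q (c * a)"] minus[of "b * d" "sc q (a * c)"]
    by (simp add: sc_diff power2_eq_square subspace_0[OF J], argo)
  also have "\<dots> \<longleftrightarrow> (\<forall>(l, r)\<in>explicit_relations a b c d. l - r \<in> J)"
    unfolding crossed_pair_mod[OF J q] by (auto simp: explicit_relations_def)
  finally show ?thesis .
qed

lemma sum_diff_mod:
  assumes J: "subspace J"
  shows "x + y \<in> J \<and> x - y \<in> J \<longleftrightarrow> x \<in> J \<and> y \<in> J"
proof (intro iffI conjI; (elim conjE)?)
  assume *: "x + y \<in> J" "x - y \<in> J"
  have "sc (1/2) ((x + y) + (x - y)) \<in> J" "sc (1/2) ((x + y) - (x - y)) \<in> J"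
    using * J by (blast intro: subspace_scale subspace_add subspace_diff)+
  moreover have "(x + y) + (x - y) = sc 2 x" "(x + y) - (x - y) = sc 2 y"
    using scale_left_distrib[of 1 1 x] scale_left_distrib[of 1 1 y] by simp_all
  ultimately show "x \<in> J" "y \<in> J" by simp_all
qed (use J in \<open>auto intro: subspace_add subspace_diff\<close>)

text \<open>Both quadruples span the products of the span of \<open>x, y\<close> with the span of
  \<open>u, v\<close>; the change of variables is made in one factor at a time.\<close>

lemma tilde_products_mod:
  assumes J: "subspace J"
  shows "x * u \<in> J \<and> x * v \<in> J \<and> y * u \<in> J \<and> y * v \<in> J \<longleftrightarrow>
    (x + y) * (u + v) \<in> J \<and> (x + y) * (u - v) \<in> J \<and> (x - y) * (u + v) \<in> J \<and> (x - y) * (u - v) \<in> J"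
  using sum_diff_mod[OF J, of "(x + y) * u" "(x + y) * v"] sum_diff_mod[OF J, of "(x - y) * u" "(x - y) * v"]
    sum_diff_mod[OF J, of "x * u" "y * u"] sum_diff_mod[OF J, of "x * v" "y * v"]
  by (auto simp: distrib_left distrib_right left_diff_distrib right_diff_distrib)

lemma tilde_relations_mod:
  assumes J: "subspace J"
  shows "(\<forall>(l, r)\<in>explicit_relations a b c d. l - r \<in> J) \<longleftrightarrow>
    (\<forall>(l, r)\<in>tilde_relations (sc (1/2) (a + d)) (sc (1/2) (b + c)) (sc (1/2) (b - c)) (sc (1/2) (a - d)). l - r \<in> J)"
proof -
  \<comment> \<open>The mixed terms \<open>x * y\<close> and \<open>y * x\<close> cancel, so the
    anticommutator of sum and difference is twice a difference of squares.\<close>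
  have anti: "(x + y) * (x - y) + (x - y) * (x + y) \<in> J \<longleftrightarrow> x^2 - y^2 \<in> J" for x y
  proof -
    have "(x + y) * (x - y) + (x - y) * (x + y) = sc 2 (x^2 - y^2)"
      using scale_left_distrib[of 1 1 "x^2 - y^2"] by (simp add: algebra_simps power2_eq_square)
    then show ?thesis using scale_mem_iff[OF J, of 2] by simp
  qed
  have prod: "sc (1/2) x * sc (1/2) y = sc (1/4) (x * y)" for x y
    by (simp add: scale_mult_left scale_mult_right)
  have "(\<forall>(l, r)\<in>explicit_relations a b c d. l - r \<in> J) \<longleftrightarrow> b^2 - c^2 \<in> J \<and> a^2 - d^2 \<in> J \<and>
      (a * b \<in> J \<and> a * c \<in> J \<and> d * b \<in> J \<and> d * c \<in> J) \<and>
      (b * a \<in> J \<and> b * d \<in> J \<and> c * a \<in> J \<and> c * d \<in> J)"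
    by (auto simp: explicit_relations_def)
  also have "\<dots> \<longleftrightarrow> (\<forall>(l, r)\<in>tilde_relations (sc (1/2) (a + d)) (sc (1/2) (b + c)) (sc (1/2) (b - c)) (sc (1/2) (a - d)). l - r \<in> J)"
    \<comment> \<open>The pair \<open>x, y\<close> is first \<open>a, d\<close> with
      \<open>b, c\<close> as \<open>u, v\<close>, then the other way round.\<close>
    unfolding tilde_products_mod[OF J, of a b c d] tilde_products_mod[OF J, of b a d c] anti[symmetric]
    by (auto simp: tilde_relations_def prod scale_right_distrib[symmetric] scale_mem_iff[OF J])
  finally show ?thesis .
qed
end

text \<open>Unlike in \<open>update_induct\<close>, the step has no freshness condition on
  \<open>k\<close>, so additivity suffices to prove it.\<close>

lemma poly_mapping_single_add_induct [case_names zero add]: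
  fixes x :: "'a \<Rightarrow>\<^sub>0 'b::monoid_add"
  assumes "P 0" and "\<And>k c x. P x \<Longrightarrow> P (Poly_Mapping.single k c + x)"
  shows "P x"
proof (induction x rule: update_induct)
  case (update f k v)
  have "Poly_Mapping.update k v f = Poly_Mapping.single k v + f"
    using update(1)
    by (intro poly_mapping_eqI) (auto simp: lookup_update lookup_add lookup_single in_keys_iff when_def)
  then show ?case using update assms(2) by simp
qed (rule assms(1))

subsection \<open>Ideals of the free algebra\<close>

text \<open>Scaling is multiplication by a constant, which makes the equivalences modulo a subspace
  available for ideals.\<close>

lemma ideal_subspace:
  assumes "ideal J free_ring"
  shows "free_algebra.subspace J"
proof (rule free_algebra.subspaceI)
  interpret ideal J free_ring by fact
  show "0 \<in> J" using additive_subgroup.zero_closed[OF additive_subgroup_axioms] by simp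
  show "x + y \<in> J" if "x \<in> J" "y \<in> J" for x y using additive_subgroup.a_closed[OF additive_subgroup_axioms that] by simp
  show "free_scale c x \<in> J" if "x \<in> J" for c x
    using I_l_closed[OF that] by (simp add: free_scale_eq)
qed

lemma ideal_mult_left: "ideal J free_ring \<Longrightarrow> x \<in> J \<Longrightarrow> y * x \<in> J"
  using ideal.I_l_closed[of J free_ring x y] by simp

lemma ideal_mult_right: "ideal J free_ring \<Longrightarrow> x \<in> J \<Longrightarrow> x * y \<in> J"
  using ideal.I_r_closed[of J free_ring x y] by simp

text \<open>A generated ideal is the intersection of the ideals containing the generators, so it
  depends only on which ideals these are.\<close>

lemma relation_ideal_eqI:
  assumes "\<And>J. ideal J free_ring \<Longrightarrow> (\<forall>(l, r)\<in>S. l - r \<in> J) \<longleftrightarrow> (\<forall>(l, r)\<in>S'. l - r \<in> J)"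
  shows "relation_ideal S = relation_ideal S'"
proof -
  have "{l - r | l r. (l, r) \<in> S} \<subseteq> J \<longleftrightarrow> {l - r | l r. (l, r) \<in> S'} \<subseteq> J" if "ideal J free_ring" for J
    using assms[OF that] by auto
  then show ?thesis by (auto simp: relation_ideal_def genideal_def)
qed

lemma ideal_relation_ideal: "ideal (relation_ideal S) free_ring"
  unfolding relation_ideal_def by (rule ring.genideal_ideal[OF ring_free_ring]) simp

lemma relation_ideal_relations: "\<forall>(l, r)\<in>S. l - r \<in> relation_ideal S"
  using ring.genideal_self[OF ring_free_ring, of "{l - r | l r. (l, r) \<in> S}"]
  by (auto simp: relation_ideal_def)

lemma relation_ideal_minimal:
  assumes "ideal J free_ring" and "\<forall>(l, r)\<in>S. l - r \<in> J"
  shows "relation_ideal S \<subseteq> J"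
  unfolding relation_ideal_def
  by (rule ring.genideal_minimal[OF ring_free_ring assms(1)]) (use assms(2) in auto)

subsection \<open>A representation of the free algebra\<close>

text \<open>The Boolean \<open>s\<close> selects the copy of the grid that is acted on; the other
  copy is sent to zero. The guard \<open>k > 0\<close> is needed since \<open>0 - 1 = 0\<close> on
  naturals.\<close>

definition raise_fst :: "bool \<Rightarrow> (bool \<times> nat \<times> nat \<Rightarrow> complex) \<Rightarrow> bool \<times> nat \<times> nat \<Rightarrow> complex" where
  "raise_fst s v = (\<lambda>(t, k, l). if t = s \<and> k > 0 then v (t, k - 1, l) else 0)"

text \<open>The sign makes this operator anticommute with \<open>raise_fst s\<close>, which shifts
  \<open>k\<close> by one.\<close>

definition raise_snd :: "bool \<Rightarrow> (bool \<times> nat \<times> nat \<Rightarrow> complex) \<Rightarrow> bool \<times> nat \<times> nat \<Rightarrow> complex" where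
  "raise_snd s v = (\<lambda>(t, k, l). if t = s \<and> l > 0 then (-1)^k * v (t, k, l - 1) else 0)"

fun act :: "generator \<Rightarrow> (bool \<times> nat \<times> nat \<Rightarrow> complex) \<Rightarrow> bool \<times> nat \<times> nat \<Rightarrow> complex" where
  "act Gen_a v i = raise_fst True v i + raise_snd True v i"
| "act Gen_d v i = raise_fst True v i - raise_snd True v i"
| "act Gen_b v i = raise_fst False v i + raise_snd False v i"
| "act Gen_c v i = raise_fst False v i - raise_snd False v i"

text \<open>This is the linear extension of the action of words; with \<open>foldr\<close> the last
  letter acts first, so concatenation becomes composition.\<close>

definition ev :: "free_algebra \<Rightarrow> (bool \<times> nat \<times> nat \<Rightarrow> complex) \<Rightarrow> bool \<times> nat \<times> nat \<Rightarrow> complex" where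
  "ev x v i = (\<Sum>w\<in>Poly_Mapping.keys x. Poly_Mapping.lookup x w * foldr act w v i)"

lemma act_linear: "act g (\<lambda>i. c * u i + v i) = (\<lambda>i. c * act g u i + act g v i)"
  by (cases g) (auto simp: fun_eq_iff raise_fst_def raise_snd_def algebra_simps)

lemma foldr_act_linear:
  "foldr act w (\<lambda>i. c * u i + v i) = (\<lambda>i. c * foldr act w u i + foldr act w v i)"
  by (induction w) (simp_all add: act_linear)

lemma foldr_act_zero: "foldr act w (\<lambda>i. 0) = (\<lambda>i. 0)"
  \<comment> \<open>For \<open>c = -1\<close> linearity expresses the image of zero as its own
    negative plus itself.\<close>
  using foldr_act_linear[of w "-1" "\<lambda>i. 0" "\<lambda>i. 0"] by simp

lemma ev_superset:
  assumes "finite A" and "Poly_Mapping.keys x \<subseteq> A"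
  shows "ev x v i = (\<Sum>w\<in>A. Poly_Mapping.lookup x w * foldr act w v i)"
  unfolding ev_def using assms by (intro sum.mono_neutral_left) (auto simp: in_keys_iff)

lemma ev_add: "ev (x + y) v = (\<lambda>i. ev x v i + ev y v i)"
proof
  fix i
  let ?A = "Poly_Mapping.keys x \<union> Poly_Mapping.keys y"
  have "ev z v i = (\<Sum>w\<in>?A. Poly_Mapping.lookup z w * foldr act w v i)" if "z \<in> {x, y, x + y}" for z
    using that keys_add[of x y] by (intro ev_superset) auto
  then show "ev (x + y) v i = ev x v i + ev y v i"
    by (simp add: lookup_add distrib_right sum.distrib)
qed

lemma ev_single: "ev (Poly_Mapping.single w c) v = (\<lambda>i. c * foldr act w v i)"
  by (auto simp: ev_def fun_eq_iff)

lemma ev_zero: "ev 0 v = (\<lambda>i. 0)"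
  by (auto simp: ev_def)

lemma ev_zero_right: "ev x (\<lambda>i. 0) = (\<lambda>i. 0)"
  by (simp add: ev_def foldr_act_zero fun_eq_iff)

lemma ev_one: "ev 1 v = v"
  unfolding single_one[symmetric] by (simp add: ev_single zero_list_def)

text \<open>Multiplicativity for a monomial on the left, by induction on the right factor;
  \<open>ev_mult\<close> then only needs additivity on the left.\<close>

lemma ev_single_mult: "ev (Poly_Mapping.single w c * y) v = (\<lambda>i. c * foldr act w (ev y v) i)"
proof (induction y rule: poly_mapping_single_add_induct)
  case (add u d y)
  show ?case
    by (simp add: distrib_left mult_single ev_add ev_single add.IH plus_list_def foldr_act_linear mult.assoc)
qed (simp add: ev_zero foldr_act_zero)

lemma ev_mult: "ev (x * y) v = ev x (ev y v)"
  by (induction x rule: poly_mapping_single_add_induct)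
    (simp_all add: ev_zero distrib_right ev_add ev_single_mult ev_single)

lemma ev_scale: "ev (free_scale c x) v = (\<lambda>i. c * ev x v i)"
  by (simp add: free_scale_eq ev_single_mult zero_list_def)

lemma ev_var: "ev (var g) v = act g v"
  by (simp add: var_def ev_single)

lemma ev_diff: "ev (x - y) v = (\<lambda>i. ev x v i - ev y v i)"
  using ev_add[of "x - y" y v] by (auto simp: fun_eq_iff)

lemma ev_power: "ev (x ^ n) v = (ev x ^^ n) v"
  by (induction n) (simp_all add: ev_one ev_mult)

text \<open>Once this kernel is known to contain the relations, minimality of the generated ideal
  makes the action pass to the quotient.\<close>

lemma ideal_ev_kernel: "ideal {x. \<forall>v. ev x v = (\<lambda>i. 0)} free_ring"
proof (rule idealI[OF ring_free_ring])
  show "subgroup {x. \<forall>v. ev x v = (\<lambda>i. 0)} (add_monoid free_ring)"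
  proof (rule group.subgroupI)
    show "Group.group (add_monoid free_ring)"
      by (rule abelian_group.a_group[OF ring.is_abelian_group[OF ring_free_ring]])
    fix x assume "x \<in> {x. \<forall>v. ev x v = (\<lambda>i. 0)}"
    moreover have "inv\<^bsub>add_monoid free_ring\<^esub> x = - x"
      using group.inv_equality[OF \<open>Group.group (add_monoid free_ring)\<close>, of "- x" x] by simp
    ultimately show "inv\<^bsub>add_monoid free_ring\<^esub> x \<in> {x. \<forall>v. ev x v = (\<lambda>i. 0)}"
      using ev_diff[of 0 x] by (simp add: ev_zero)
  qed (auto simp: ev_add ev_zero intro: exI[of _ 0])
qed (auto simp: ev_mult ev_zero_right)

subsection \<open>The tilde generators\<close>

text \<open>Lifts of \<open>S14_a q\<close>, \<open>S14_d q\<close>, \<open>S14_b q\<close> and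
  \<open>S14_c q\<close> to the free algebra.\<close>

definition tilde_a :: free_algebra where "tilde_a = free_scale (1/2) (var Gen_a + var Gen_d)"
definition tilde_d :: free_algebra where "tilde_d = free_scale (1/2) (var Gen_a - var Gen_d)"
definition tilde_b :: free_algebra where "tilde_b = free_scale (1/2) (var Gen_b + var Gen_c)"
definition tilde_c :: free_algebra where "tilde_c = free_scale (1/2) (var Gen_b - var Gen_c)"

lemma half_sum_diff:
  "free_scale (1/2) (x + y) + free_scale (1/2) (x - y) = x"
  "free_scale (1/2) (x + y) - free_scale (1/2) (x - y) = y"
proof -
  have "free_scale (1/2) (z + z) = z" for z
    using free_algebra.scale_left_distrib[of "1/2" "1/2" z] by (simp add: free_algebra.scale_right_distrib)
  then show "free_scale (1/2) (x + y) + free_scale (1/2) (x - y) = x"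
    "free_scale (1/2) (x + y) - free_scale (1/2) (x - y) = y"
    by (simp_all add: free_algebra.scale_right_distrib[symmetric]
        free_algebra.scale_right_diff_distrib[symmetric])
qed

lemma var_eq_tilde:
  "var Gen_a = tilde_a + tilde_d" "var Gen_d = tilde_a - tilde_d"
  "var Gen_b = tilde_b + tilde_c" "var Gen_c = tilde_b - tilde_c"
  by (simp_all add: tilde_a_def tilde_b_def tilde_c_def tilde_d_def half_sum_diff)

lemma ev_tilde:
  "ev tilde_a = raise_fst True" "ev tilde_d = raise_snd True"
  "ev tilde_b = raise_fst False" "ev tilde_c = raise_snd False"
  by (auto simp: fun_eq_iff tilde_a_def tilde_b_def tilde_c_def tilde_d_def ev_scale ev_add ev_diff ev_var)

text \<open>Mixed products vanish because their factors live on different copies; the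
  anticommutators vanish because \<open>(-1)^k\<close> and \<open>(-1)^(k - 1)\<close> cancel for
  \<open>k > 0\<close>.\<close>

lemma tilde_relations_ev_kernel:
  "\<forall>(l, r)\<in>tilde_relations tilde_a tilde_b tilde_c tilde_d. l - r \<in> {x. \<forall>v. ev x v = (\<lambda>i. 0)}"
  by (auto simp: tilde_relations_def ev_mult ev_add ev_tilde raise_fst_def raise_snd_def fun_eq_iff
      power_eq_if)

definition vac :: "bool \<times> nat \<times> nat \<Rightarrow> complex" where
  "vac = (\<lambda>(t, i, j). of_bool (i = 0 \<and> j = 0))"

text \<open>No sign appears because the first index is still 0. The alternative \<open>l = 0\<close>
  records that the unraised vector is supported on both copies.\<close>

lemma raise_snd_vac: "(raise_snd s ^^ l) vac = (\<lambda>(t, i, j). of_bool (i = 0 \<and> j = l \<and> (t = s \<or> l = 0)))"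
  by (induction l) (auto simp: vac_def raise_snd_def fun_eq_iff)

lemma raise_vac:
  "(raise_fst s ^^ k) ((raise_snd s ^^ l) vac) =
    (\<lambda>(t, i, j). of_bool (i = k \<and> j = l \<and> (t = s \<or> k = 0 \<and> l = 0)))"
  by (induction k) (auto simp: raise_snd_vac raise_fst_def fun_eq_iff)

lemma ev_monomial:
  "ev (tilde_a ^ k * tilde_d ^ l) vac (t, i, j) = of_bool (i = k \<and> j = l \<and> (t \<or> k = 0 \<and> l = 0))"
  "ev (tilde_b ^ k * tilde_c ^ l) vac (t, i, j) = of_bool (i = k \<and> j = l \<and> (\<not> t \<or> k = 0 \<and> l = 0))"
  by (simp_all add: ev_mult ev_power ev_tilde raise_vac)

subsection \<open>Normal monomials span\<close>

lemma anticommuting_monomial: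
  assumes J: "ideal J free_ring" and xy: "x * y + y * x \<in> J"
  shows "y * (x ^ k * y ^ l) - (-1) ^ k * (x ^ k * y ^ Suc l) \<in> J"
proof (induction k)
  case 0
  then show ?case using free_algebra.subspace_0[OF ideal_subspace[OF J]] by simp
next
  case (Suc k)
  \<comment> \<open>Replace \<open>y * x\<close> by the anticommutator minus \<open>x * y\<close>,
    then apply the induction hypothesis under left multiplication by \<open>x\<close>.\<close>
  have "(x * y + y * x) * (x ^ k * y ^ l) - x * (y * (x ^ k * y ^ l) - (-1) ^ k * (x ^ k * y ^ Suc l)) \<in> J"
    by (intro free_algebra.subspace_diff[OF ideal_subspace[OF J]] ideal_mult_left[OF J]
        ideal_mult_right[OF J] xy Suc)
  also have "(x * y + y * x) * (x ^ k * y ^ l) - x * (y * (x ^ k * y ^ l) - (-1) ^ k * (x ^ k * y ^ Suc l))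
      = y * (x ^ Suc k * y ^ l) - (-1) ^ Suc k * (x ^ Suc k * y ^ Suc l)"
    \<comment> \<open>The sign is an element of a noncommutative ring; parity turns it into 1 or
      -1.\<close>
    by (cases "even k") (simp_all add: algebra_simps)
  finally show ?case .
qed

text \<open>A monomial other than the unit begins with \<open>x\<close>, or with \<open>y\<close> if
  \<open>k = 0\<close>.\<close>

lemma annihilated_monomial:
  assumes J: "ideal J free_ring" and "u * x \<in> J" "u * y \<in> J" and "k \<noteq> 0 \<or> l \<noteq> 0"
  shows "u * (x ^ k * y ^ l) \<in> J"
proof (cases k)
  case 0
  then show ?thesis
    using assms ideal_mult_right[OF J, of "u * y" "y ^ (l - 1)"] by (cases l) (auto simp: mult.assoc)
next
  case (Suc m)
  then show ?thesis
    using assms ideal_mult_right[OF J, of "u * x" "x ^ m * y ^ l"] by (simp add: mult.assoc)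
qed

definition ad_monomials :: "free_algebra set" where
  "ad_monomials = {tilde_a ^ k * tilde_d ^ l | k l. True}"

definition bc_monomials :: "free_algebra set" where
  "bc_monomials = {tilde_b ^ k * tilde_c ^ l | k l. True}"

text \<open>The span contains 1 and is closed under left multiplication by the generators, hence
  contains every word. Including \<open>J\<close> among the spanning elements allows computing
  modulo \<open>J\<close> inside the free algebra.\<close>

lemma tilde_monomials_span:
  assumes J: "ideal J free_ring"
    and rel: "\<forall>(l, r)\<in>tilde_relations tilde_a tilde_b tilde_c tilde_d. l - r \<in> J"
  shows "free_algebra.span (ad_monomials \<union> bc_monomials \<union> J) = UNIV" (is "?W = UNIV")
proof -
  let ?B = "ad_monomials \<union> bc_monomials"
  have JW: "x \<in> J \<Longrightarrow> x \<in> ?W" for x by (auto intro: free_algebra.span_base)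
  have adW: "tilde_a ^ k * tilde_d ^ l \<in> ?W" for k l
    by (auto simp: ad_monomials_def intro!: free_algebra.span_base)
  have bcW: "tilde_b ^ k * tilde_c ^ l \<in> ?W" for k l
    by (auto simp: bc_monomials_def intro!: free_algebra.span_base)
  have raise: "y * (x ^ k * y ^ l) \<in> ?W"
    if "x * y + y * x \<in> J" and "x ^ k * y ^ Suc l \<in> ?W" for x y k l
  proof -
    have "(-1) ^ k * (x ^ k * y ^ Suc l) \<in> ?W"
      using that(2) free_algebra.span_neg by (cases "even k") auto
    from free_algebra.span_add[OF JW[OF anticommuting_monomial[OF J that(1), of k l]] this]
    show ?thesis by simp
  qed
  \<comment> \<open>On the unit monomial the product is \<open>u\<close> itself, hence the third
    premise.\<close>
  have kill: "u * (x ^ k * y ^ l) \<in> ?W" if "u * x \<in> J" "u * y \<in> J" "u \<in> ?W" for u x y k l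
    using annihilated_monomial[OF J that(1,2), of k l] that(3) JW by (cases "k = 0 \<and> l = 0") auto
  have gens: "tilde_a \<in> ?W" "tilde_d \<in> ?W" "tilde_b \<in> ?W" "tilde_c \<in> ?W"
    using adW[of 1 0] adW[of 0 1] bcW[of 1 0] bcW[of 0 1] by simp_all
  have base: "u * z \<in> ?W"
    if u: "u \<in> {tilde_a, tilde_b, tilde_c, tilde_d}" and z: "z \<in> ?B \<union> J" for u z
  proof -
    consider "z \<in> J" | k l where "z = tilde_a ^ k * tilde_d ^ l" | k l where "z = tilde_b ^ k * tilde_c ^ l"
      using z by (auto simp: ad_monomials_def bc_monomials_def)
    then show ?thesis
    proof cases
      case 1
      then show ?thesis using ideal_mult_left[OF J] JW by blast
    next
      \<comment> \<open>Here \<open>tilde_a\<close> raises the first exponent,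
        \<open>tilde_d\<close> anticommutes past the first power, and \<open>tilde_b\<close>,
        \<open>tilde_c\<close> annihilate; the third case is symmetric.\<close>
      case (2 k l)
      then show ?thesis
        using u rel gens adW[of "Suc k" l] raise[OF _ adW, of k l]
          kill[of tilde_b tilde_a tilde_d k l] kill[of tilde_c tilde_a tilde_d k l]
        by (auto simp: tilde_relations_def mult.assoc)
    next
      case (3 k l)
      then show ?thesis
        using u rel gens bcW[of "Suc k" l] raise[OF _ bcW, of k l]
          kill[of tilde_a tilde_b tilde_c k l] kill[of tilde_d tilde_b tilde_c k l]
        by (auto simp: tilde_relations_def mult.assoc)
    qed
  qed
  have tilde_mult: "u * z \<in> ?W" if "u \<in> {tilde_a, tilde_b, tilde_c, tilde_d}" "z \<in> ?W" for u z
    using that(2)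
  proof (induction rule: free_algebra.span_induct_alt)
    case (step c x y)
    then show ?case
      using base[OF that(1) step(1)]
      by (simp add: distrib_left free_algebra.scale_mult_right free_algebra.span_add free_algebra.span_scale)
  qed (simp add: free_algebra.span_zero)
  have var_mult: "var g * z \<in> ?W" if "z \<in> ?W" for g z
    using tilde_mult[OF _ that]
    by (cases g) (simp_all add: var_eq_tilde distrib_right left_diff_distrib
        free_algebra.span_add free_algebra.span_diff)
  have word: "Poly_Mapping.single w 1 \<in> ?W" for w
  proof (induction w)
    case Nil
    have "1 \<in> ?W" using adW[of 0 0] by simp
    then show ?case by (simp add: zero_list_def flip: single_one)
  next
    case (Cons g w)
    then show ?case
      using var_mult[of "Poly_Mapping.single w 1" g] by (simp add: var_def mult_single plus_list_def)
  qed
  have "x \<in> ?W" for x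
  proof (induction x rule: poly_mapping_single_add_induct)
    case (add w c x)
    have "Poly_Mapping.single w c = free_scale c (Poly_Mapping.single w 1)"
      by (simp add: free_scale_eq mult_single zero_list_def plus_list_def)
    then show ?case
      using add word by (simp add: free_algebra.span_add free_algebra.span_scale)
  qed (rule free_algebra.span_zero)
  then show ?thesis by blast
qed

subsection \<open>The quotient algebra\<close>

lemma S14_ideal_eq:
  assumes "q \<noteq> 0" and "q^2 \<noteq> 1"
  shows "S14_ideal q = relation_ideal (tilde_relations tilde_a tilde_b tilde_c tilde_d)"
    and "S14_ideal q = relation_ideal (explicit_relations (var Gen_a) (var Gen_b) (var Gen_c) (var Gen_d))"
  unfolding S14_ideal_def tilde_a_def tilde_b_def tilde_c_def tilde_d_def
  by (rule relation_ideal_eqI,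
      simp only: free_algebra.explicit_relations_mod[OF ideal_subspace assms]
        free_algebra.tilde_relations_mod[OF ideal_subspace])+

lemma S14_class_eq_iff: "S14_class q x = S14_class q y \<longleftrightarrow> x - y \<in> S14_ideal q"
proof -
  note J = ideal_subspace[OF ideal_S14_ideal[of q]]
  have mem: "z \<in> S14_class q w \<longleftrightarrow> z - w \<in> S14_ideal q" for z w
    by (auto simp: S14_class_def a_r_coset_def' intro: bexI[of _ "z - w"])
  show ?thesis
  proof
    assume "S14_class q x = S14_class q y"
    then show "x - y \<in> S14_ideal q"
      using mem[of x x] mem[of x y] free_algebra.subspace_0[OF J] by simp
  next
    assume "x - y \<in> S14_ideal q"
    then have "z - x \<in> S14_ideal q \<longleftrightarrow> z - y \<in> S14_ideal q" for z
      using free_algebra.subspace_add[OF J, of "z - x" "x - y"]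
        free_algebra.subspace_diff[OF J, of "z - y" "x - y"] by auto
    then show "S14_class q x = S14_class q y"
      using mem by blast
  qed
qed

lemma S14_class_minus: "S14_class q x \<ominus>\<^bsub>S14 q\<^esub> S14_class q y = S14_class q (x - y)"
proof -
  interpret abelian_group "S14 q" by (rule abelian_group_S14)
  have "\<ominus>\<^bsub>S14 q\<^esub> S14_class q y = S14_class q (- y)"
    by (rule minus_equality) (auto simp: S14_class_simps S14_carrier)
  then show ?thesis by (simp add: a_minus_def S14_class_simps)
qed

lemma S14_class_power: "S14_class q x [^]\<^bsub>S14 q\<^esub> (n::nat) = S14_class q (x ^ n)"
  \<comment> \<open>\<open>nat_pow\<close> appends the new factor on the right and
    \<open>power\<close> on the left, hence \<open>power_commutes\<close>.\<close>
  by (induction n) (simp_all add: nat_pow_def S14_class_simps power_commutes)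

lemma S14_tilde:
  "S14_a q = S14_class q tilde_a" "S14_b q = S14_class q tilde_b"
  "S14_c q = S14_class q tilde_c" "S14_d q = S14_class q tilde_d"
  by (simp_all add: S14_a_def S14_b_def S14_c_def S14_d_def tilde_a_def tilde_b_def tilde_c_def tilde_d_def
      S14_class_simps S14_class_minus)

lemma mono_eq_class:
  "mono_ad q (k, l) = S14_class q (tilde_a ^ k * tilde_d ^ l)"
  "mono_bc q (k, l) = S14_class q (tilde_b ^ k * tilde_c ^ l)"
  by (simp_all add: mono_ad_def mono_bc_def S14_tilde S14_class_power S14_class_simps)

text \<open>Choosing representatives turns a linear combination of classes into the class of a
  finite sum to which \<open>ev\<close> applies.\<close>

lemma S14_lincomb:
  assumes "finite A" and "A \<subseteq> carrier (S14 q)"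
  shows "\<exists>r. (\<forall>X\<in>A. S14_class q (r X) = X) \<and>
    module.lincomb (S14 q) a A = S14_class q (\<Sum>X\<in>A. free_scale (a X) (r X))"
proof -
  interpret vectorspace complex_field "S14 q" by (rule vectorspace_S14)
  have "\<forall>X\<in>A. \<exists>x. S14_class q x = X"
    using assms(2) by (auto simp: S14_carrier)
  then obtain r where r: "\<forall>X\<in>A. S14_class q (r X) = X"
    by (auto dest: bchoice)
  have "lincomb a A = S14_class q (\<Sum>X\<in>A. free_scale (a X) (r X))"
    using assms(1) r
  proof (induction A)
    case (insert X A)
    have X: "a X \<odot>\<^bsub>S14 q\<^esub> X = S14_class q (free_scale (a X) (r X))"
      using insert.prems S14_class_simps(5)[of q "a X" "r X"] by simp
    have "(\<lambda>v. a v \<odot>\<^bsub>S14 q\<^esub> v) \<in> A \<rightarrow> carrier (S14 q)"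
    proof
      fix Y assume "Y \<in> A"
      then show "a Y \<odot>\<^bsub>S14 q\<^esub> Y \<in> carrier (S14 q)"
        using insert.prems S14_class_simps(5)[of q "a Y" "r Y"] by (simp add: S14_carrier)
    qed
    then have "lincomb a (insert X A) = a X \<odot>\<^bsub>S14 q\<^esub> X \<oplus>\<^bsub>S14 q\<^esub> lincomb a A"
      unfolding lincomb_def using insert.hyps by (intro M.finsum_insert) (auto simp: X S14_carrier)
    then show ?case
      using insert X by (simp add: S14_class_simps)
  qed (simp add: lincomb_def S14_class_simps)
  with r show ?thesis by blast
qed

text \<open>A dual family argument: the functional \<open>ev x v i\<close> vanishes on the ideal,
  and applied to a linear relation it isolates the coefficient of \<open>X\<close>.\<close>

lemma S14_lin_indpt:
  assumes sub: "B \<subseteq> carrier (S14 q)"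
    and ker: "\<And>x v i. x \<in> S14_ideal q \<Longrightarrow> ev x v i = 0"
    and dual: "\<And>X. X \<in> B \<Longrightarrow> \<exists>v i. \<forall>x. S14_class q x \<in> B \<longrightarrow> ev x v i = of_bool (S14_class q x = X)"
  shows "\<not> module.lin_dep complex_field (S14 q) B"
proof
  interpret vectorspace complex_field "S14 q" by (rule vectorspace_S14)
  assume "lin_dep B"
  then obtain A a X where A: "finite A" "A \<subseteq> B" "lincomb a A = \<zero>\<^bsub>S14 q\<^esub>" "X \<in> A" "a X \<noteq> 0"
    by (auto simp: lin_dep_def)
  obtain v i where dual_X: "\<And>x. S14_class q x \<in> B \<Longrightarrow> ev x v i = of_bool (S14_class q x = X)"
    using dual[of X] A by blast
  obtain r where r: "\<forall>Y\<in>A. S14_class q (r Y) = Y"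
    and eq: "lincomb a A = S14_class q (\<Sum>Y\<in>A. free_scale (a Y) (r Y))"
    using S14_lincomb[OF A(1), of q a] A(2) sub by auto
  have "(\<Sum>Y\<in>A. free_scale (a Y) (r Y)) \<in> S14_ideal q"
    using A(3) eq S14_class_eq_iff[of q _ 0] by (simp add: S14_class_simps)
  then have "0 = ev (\<Sum>Y\<in>A. free_scale (a Y) (r Y)) v i"
    using ker by simp
  also have "\<dots> = (\<Sum>Y\<in>A. a Y * ev (r Y) v i)"
    using A(1) by (induction A) (simp_all add: ev_zero ev_add ev_scale)
  also have "\<dots> = (\<Sum>Y\<in>A. if Y = X then a Y else 0)"
    using r A(2) dual_X by (intro sum.cong refl) (auto simp: subset_iff)
  also have "\<dots> = a X"
    using A(1,4) by simp
  finally show False using A(5) by simp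
qed

text \<open>The preimage of the span under the class map is a subspace containing \<open>B\<close>
  and the ideal, hence everything.\<close>

lemma S14_gen_set:
  assumes "free_algebra.span (B \<union> S14_ideal q) = UNIV"
  shows "module.span complex_field (S14 q) (S14_class q ` B) = carrier (S14 q)"
proof -
  interpret vectorspace complex_field "S14 q" by (rule vectorspace_S14)
  have sub: "S14_class q ` B \<subseteq> carrier (S14 q)" by (auto simp: S14_carrier)
  interpret S: submodule complex_field "span (S14_class q ` B)" "S14 q"
    by (rule span_is_submodule[OF sub])
  let ?W = "{x. S14_class q x \<in> span (S14_class q ` B)}"
  have "free_algebra.subspace ?W"
  proof (rule free_algebra.subspaceI)
    show "0 \<in> ?W" using S.zero_closed by (simp add: S14_class_simps)
    show "x + y \<in> ?W" if "x \<in> ?W" "y \<in> ?W" for x y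
      using S.m_closed[of "S14_class q x" "S14_class q y"] that by (simp add: S14_class_simps)
    show "free_scale c x \<in> ?W" if "x \<in> ?W" for c x
      using S.smult_closed[of c "S14_class q x"] that by (simp add: S14_class_simps)
  qed
  moreover have "B \<union> S14_ideal q \<subseteq> ?W"
  proof -
    have "S14_class q x = \<zero>\<^bsub>S14 q\<^esub>" if "x \<in> S14_ideal q" for x
      using that S14_class_eq_iff[of q x 0] by (simp add: S14_class_simps)
    then show ?thesis using in_own_span[OF sub] S.zero_closed by auto
  qed
  ultimately have "?W = UNIV"
    using free_algebra.span_minimal assms by blast
  then show ?thesis
    using span_is_subset2[OF sub] by (auto simp: S14_carrier)
qed

theorem mainTheorem7:
  fixes q :: complex and sc :: "complex \<Rightarrow> 'A::ring_1 \<Rightarrow> 'A"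
  assumes "q \<noteq> 0" and "q^2 \<noteq> 1" and "complex_algebra sc"
  shows
    "(\<forall>a b c d :: 'A.
        (satisfied (RTT_relations sc q a b c d) \<longleftrightarrow> satisfied (explicit_relations a b c d)) \<and>
        (satisfied (RTT_relations sc q a b c d) \<longleftrightarrow>
          satisfied (tilde_relations
            (sc (1/2) (a + d)) (sc (1/2) (b + c))
            (sc (1/2) (b - c)) (sc (1/2) (a - d)))))
     \<and>
     (let a = var Gen_a; b = var Gen_b; c = var Gen_c; d = var Gen_d in
        S14_ideal q = relation_ideal (explicit_relations a b c d) \<and>
        S14_ideal q = relation_ideal (tilde_relations
            (free_scale (1/2) (a + d)) (free_scale (1/2) (b + c))
            (free_scale (1/2) (b - c)) (free_scale (1/2) (a - d))))
     \<and>
     inj (mono_ad q) \<and> inj (mono_bc q) \<and>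
     range (mono_ad q) \<inter> range (mono_bc q) = {\<one>\<^bsub>S14 q\<^esub>} \<and>
     vectorspace.basis complex_field (S14 q) (range (mono_ad q) \<union> range (mono_bc q))"
proof (intro conjI)
  interpret A: complex_algebra sc by fact
  have zero: "A.subspace {0}" by (rule A.subspace_single_0)
  show "\<forall>a b c d :: 'A.
        (satisfied (RTT_relations sc q a b c d) \<longleftrightarrow> satisfied (explicit_relations a b c d)) \<and>
        (satisfied (RTT_relations sc q a b c d) \<longleftrightarrow>
          satisfied (tilde_relations
            (sc (1/2) (a + d)) (sc (1/2) (b + c))
            (sc (1/2) (b - c)) (sc (1/2) (a - d))))"
    unfolding relations_mod_singleton_zero A.explicit_relations_mod[OF zero assms(1,2)]
      A.tilde_relations_mod[OF zero] by simp
  show "let a = var Gen_a; b = var Gen_b; c = var Gen_c; d = var Gen_d in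
        S14_ideal q = relation_ideal (explicit_relations a b c d) \<and>
        S14_ideal q = relation_ideal (tilde_relations
            (free_scale (1/2) (a + d)) (free_scale (1/2) (b + c))
            (free_scale (1/2) (b - c)) (free_scale (1/2) (a - d)))"
    using S14_ideal_eq[OF assms(1,2)]
    by (simp add: Let_def tilde_a_def tilde_b_def tilde_c_def tilde_d_def)
  note J_tilde = S14_ideal_eq(1)[OF assms(1,2)]
  have ker: "ev x v i = 0" if "x \<in> S14_ideal q" for x v i
    using relation_ideal_minimal[OF ideal_ev_kernel tilde_relations_ev_kernel] that
    by (auto simp: J_tilde)
  \<comment> \<open>The coordinates of the image of \<open>vac\<close> depend only on the
    class.\<close>
  have coord: "ev x vac i = ev y vac i" if "S14_class q x = S14_class q y" for x y i
    using that ker[of "x - y" vac i] by (simp add: S14_class_eq_iff ev_diff)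
  have coord_ad: "ev x vac (t, i, j) = of_bool (i = k \<and> j = l \<and> (t \<or> k = 0 \<and> l = 0))"
    if "S14_class q x = mono_ad q (k, l)" for x t i j k l
    using coord[of x "tilde_a ^ k * tilde_d ^ l"] that by (simp add: mono_eq_class ev_monomial)
  have coord_bc: "ev x vac (t, i, j) = of_bool (i = k \<and> j = l \<and> (\<not> t \<or> k = 0 \<and> l = 0))"
    if "S14_class q x = mono_bc q (k, l)" for x t i j k l
    using coord[of x "tilde_b ^ k * tilde_c ^ l"] that by (simp add: mono_eq_class ev_monomial)
  \<comment> \<open>The first monomial has coordinate 1 at \<open>(True, k, l)\<close>, which forces
    the exponents of the second.\<close>
  have ad_eqD: "k = k' \<and> l = l'" if "mono_ad q (k, l) = mono_ad q (k', l')" for k l k' l'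
    using coord_ad[OF mono_eq_class(1)[symmetric], of k l True k l] that
      coord_ad[of "tilde_a ^ k * tilde_d ^ l" k' l' True k l]
    by (simp add: mono_eq_class split: if_splits)
  have bc_eqD: "k = k' \<and> l = l'" if "mono_bc q (k, l) = mono_bc q (k', l')" for k l k' l'
    using coord_bc[OF mono_eq_class(2)[symmetric], of k l False k l] that
      coord_bc[of "tilde_b ^ k * tilde_c ^ l" k' l' False k l]
    by (simp add: mono_eq_class split: if_splits)
  \<comment> \<open>A monomial in \<open>tilde_b\<close>, \<open>tilde_c\<close> with a nonzero
    coordinate on the \<open>True\<close> copy must be the unit.\<close>
  have ad_bc_eqD: "k = 0 \<and> l = 0 \<and> k' = 0 \<and> l' = 0" if "mono_ad q (k, l) = mono_bc q (k', l')" for k l k' l'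
    using coord_ad[OF mono_eq_class(1)[symmetric], of k l True k l]
      coord_ad[OF mono_eq_class(1)[symmetric], of k l False k' l']
      coord_bc[of "tilde_a ^ k * tilde_d ^ l" k' l' True k l]
      coord_bc[of "tilde_a ^ k * tilde_d ^ l" k' l' False k' l'] that
    by (simp add: mono_eq_class split: if_splits)
  show "inj (mono_ad q)" "inj (mono_bc q)"
    using ad_eqD bc_eqD by (auto intro!: injI)
  have one: "mono_ad q (0, 0) = \<one>\<^bsub>S14 q\<^esub>" "mono_bc q (0, 0) = \<one>\<^bsub>S14 q\<^esub>"
    by (simp_all add: mono_eq_class S14_class_simps)
  show "range (mono_ad q) \<inter> range (mono_bc q) = {\<one>\<^bsub>S14 q\<^esub>}"
  proof (intro equalityI subsetI)
    fix X assume "X \<in> range (mono_ad q) \<inter> range (mono_bc q)"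
    then obtain p p' where "X = mono_ad q p" "X = mono_bc q p'" by blast
    then show "X \<in> {\<one>\<^bsub>S14 q\<^esub>}"
      using ad_bc_eqD[of "fst p" "snd p" "fst p'" "snd p'"] one by (cases p) simp
  next
    fix X assume "X \<in> {\<one>\<^bsub>S14 q\<^esub>}"
    then show "X \<in> range (mono_ad q) \<inter> range (mono_bc q)"
      using one by (metis IntI rangeI singletonD)
  qed
  let ?B = "range (mono_ad q) \<union> range (mono_bc q)"
  have B: "?B = S14_class q ` (ad_monomials \<union> bc_monomials)"
    by (force simp: ad_monomials_def bc_monomials_def mono_eq_class image_iff)
  have sub: "?B \<subseteq> carrier (S14 q)"
    by (auto simp: S14_carrier mono_eq_class)
  have "\<exists>v i. \<forall>x. S14_class q x \<in> ?B \<longrightarrow> ev x v i = of_bool (S14_class q x = X)"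
    if "X \<in> ?B" for X
  proof -
    \<comment> \<open>The coordinate at \<open>(True, k, l)\<close> is the functional dual to
      \<open>mono_ad q (k, l)\<close>. In its second case only the unit is nonzero there, and
      \<open>one\<close> identifies it with \<open>mono_ad q (0, 0)\<close>.\<close>
    have ad: "ev x vac (True, k, l) = of_bool (S14_class q x = mono_ad q (k, l))"
      if "S14_class q x \<in> ?B" for x k l
    proof -
      from that consider k' l' where "S14_class q x = mono_ad q (k', l')"
        | k' l' where "S14_class q x = mono_bc q (k', l')" by auto
      then show ?thesis
      proof cases
        case 1
        then show ?thesis using ad_eqD[of k' l' k l] coord_ad[OF 1, of True k l] by auto
      next
        case 2
        then show ?thesis using ad_bc_eqD[of k l k' l'] one coord_bc[OF 2, of True k l] by auto
      qed
    qed
    have bc: "ev x vac (False, k, l) = of_bool (S14_class q x = mono_bc q (k, l))"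
      if "S14_class q x \<in> ?B" for x k l
    proof -
      from that consider k' l' where "S14_class q x = mono_ad q (k', l')"
        | k' l' where "S14_class q x = mono_bc q (k', l')" by auto
      then show ?thesis
      proof cases
        case 1
        then show ?thesis using ad_bc_eqD[of k' l' k l] one coord_ad[OF 1, of False k l] by auto
      next
        case 2
        then show ?thesis using bc_eqD[of k' l' k l] coord_bc[OF 2, of False k l] by auto
      qed
    qed
    from that consider k l where "X = mono_ad q (k, l)" | k l where "X = mono_bc q (k, l)"
      by auto
    then show ?thesis
    proof cases
      case (1 k l)
      then show ?thesis using ad by (intro exI[of _ vac] exI[of _ "(True, k, l)"]) simp
    next
      case (2 k l)
      then show ?thesis using bc by (intro exI[of _ vac] exI[of _ "(False, k, l)"]) simp
    qed
  qed
  then have indpt: "\<not> module.lin_dep complex_field (S14 q) ?B"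
    using S14_lin_indpt[OF sub ker] by blast
  have "free_algebra.span (ad_monomials \<union> bc_monomials \<union> S14_ideal q) = UNIV"
    unfolding J_tilde by (rule tilde_monomials_span[OF ideal_relation_ideal relation_ideal_relations])
  from S14_gen_set[OF this] indpt sub show "vectorspace.basis complex_field (S14 q) ?B"
    unfolding vectorspace.basis_def[OF vectorspace_S14] B by blast
qed

end
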